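(* Let $\mathcal A$ be either $\mathbb C^q$ with componentwise complex conjugation $*$ as involution, or $\mathbb R^q$ (with trivial involution). Let $V=\{1,\dots,N\}$ and let $w_{ij}=w_{ji}=w_{ij}^*\in\mathcal A$ be symmetric self-adjoint weights with $w_{ii}=0$. Then for every vertex function $f\in\mathcal A^V$, $$\Delta_w f=\partial\delta f=-[1,f],$$ where $1\in\mathcal A^V$ is the constant function with value $1_{\mathcal A}$. Moreover, for every $f\in\mathcal A^V$ and $j\in V$, $$(\delta^\dagger\delta f)_j=(\Delta_{w^2}f)_j:=\sum_k w_{jk}^2(f_j-f_k).$$ If in addition $w_{ij}w_{ik}=0$ for all $i$ and all $j\neq k$, then $$\Delta_w^2=2\Delta_{w^2}=2\delta^\dagger\delta .$$
   Context: Here $(\Delta_w f)_i=\sum_j w_{ij}(f_i-f_j)$ is the weighted graph Laplacian and $[f,g]_i=\sum_j w_{ij}(f_ig_j-f_jg_i)$ is the graph bracket on $\mathcal A^V$. With $\{e_i\}$ the coordinate basis of $\mathcal A^V$, the map $\delta:\mathcal A^V\to\bigwedge^2\mathcal A^V$ is $\delta(f)=\sum_{i<j}w_{ij}(f_i-f_j)\,e_i\wedge e_j$ (equivalently $\delta(e_i)=\sum_j w_{ij}e_i\wedge e_j$). The boundary is the $\mathcal A$-linear map $\partial(e_i\wedge e_j)=e_i-e_j$ for $i<j$. The vertex module carries the $\mathcal A$-valued inner product $\langle f,g\rangle=\sum_i f_i^*g_i$, the edge module carries the analogous $\mathcal A$-valued inner product for which $\{e_i\wedge e_j\}_{i<j}$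 is orthonormal, and $\delta^\dagger$ is the adjoint of $\delta$ with respect to these inner products. *)

theory Defs
  imports "HOL-Analysis.Analysis"
begin

section \<open>Coefficient algebras with involution\<close>

class comm_star_ring = comm_ring_1 +
  fixes star :: "'a \<Rightarrow> 'a"
  assumes star_add: "star (a + b) = star a + star b"
    and star_mult: "star (a * b) = star a * star b"
    and star_star [simp]: "star (star a) = a"

instantiation real :: comm_star_ring
begin
definition star_real :: "real \<Rightarrow> real" where "star_real x = x"
instance by standard (simp_all add: star_real_def)
end

instantiation complex :: comm_star_ring
begin
definition star_complex :: "complex \<Rightarrow> complex" where "star_complex z = cnj z"
instance by standard (simp_all add: star_complex_def)
end

text \<open>The library's ring structure on \<open>'a ^ 'q\<close> is componentwise, so with the following
  instance \<open>complex ^ 'q\<close> and \<open>real ^ 'q\<close> are the involutive algebras $C^q$ and $R^q$.\<close>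

instantiation vec :: (comm_star_ring, finite) comm_star_ring
begin
definition star_vec :: "'a ^ 'b \<Rightarrow> 'a ^ 'b" where "star_vec x = (\<chi> k. star (x $ k))"
instance
  by standard (simp_all add: star_vec_def vec_eq_iff star_add star_mult)
end

section \<open>Vertex functions, Laplacian and bracket\<close>

text \<open>The vertex set $\{1, \dots, N\}$ is a finite linearly ordered type \<open>'v\<close>, a vertex function
  with values in the algebra \<open>'a\<close> is an element of \<open>'a ^ 'v\<close>, and the algebra acts on vertex
  functions by the library's \<open>*s\<close>.\<close>

definition admissible_weights :: "('v \<Rightarrow> 'v \<Rightarrow> 'a::comm_star_ring) \<Rightarrow> bool" where
  "admissible_weights w \<longleftrightarrow>
     (\<forall>i j. w i j = w j i) \<and> (\<forall>i j. star (w i j) = w i j) \<and> (\<forall>i. w i i = 0)"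

definition laplacian :: "('v::finite \<Rightarrow> 'v \<Rightarrow> 'a::comm_ring_1) \<Rightarrow> 'a ^ 'v \<Rightarrow> 'a ^ 'v" where
  "laplacian w f = (\<chi> i. \<Sum>j\<in>UNIV. w i j * (f $ i - f $ j))"

definition bracket ::
  "('v::finite \<Rightarrow> 'v \<Rightarrow> 'a::comm_ring_1) \<Rightarrow> 'a ^ 'v \<Rightarrow> 'a ^ 'v \<Rightarrow> 'a ^ 'v" where
  "bracket w f g = (\<chi> i. \<Sum>j\<in>UNIV. w i j * (f $ i * g $ j - f $ j * g $ i))"

definition vbasis :: "'v::finite \<Rightarrow> ('a::comm_ring_1) ^ 'v" where
  "vbasis i = axis i 1"

definition vinner :: "('a::comm_star_ring) ^ 'v \<Rightarrow> 'a ^ 'v \<Rightarrow> 'a" where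
  "vinner f g = (\<Sum>i\<in>UNIV. star (f $ i) * g $ i)"

section \<open>The exterior square of the vertex module\<close>

text \<open>The exterior square of the free module \<open>'a ^ 'v\<close> is realised as the module \<open>ext2\<close> of
  alternating arrays, with $(f \wedge g)_{ij} = f_i g_j - f_j g_i$.  The elements
  $e_i \wedge e_j$ with $i < j$ form a basis, and the coordinate of \<open>F\<close> at $e_i \wedge e_j$ is
  \<open>F $ i $ j\<close> (see \<open>ext2_expansion\<close>).\<close>

type_synonym ('a, 'v) array = "(('a, 'v) vec, 'v) vec"

definition ext2 :: "('a::comm_ring_1, 'v::finite) array set" where
  "ext2 = {F. (\<forall>i. F $ i $ i = 0) \<and> (\<forall>i j. F $ j $ i = - (F $ i $ j))}"

definition wedge :: "('a::comm_ring_1) ^ 'v \<Rightarrow> 'a ^ 'v \<Rightarrow> ('a, 'v) array" where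
  "wedge f g = (\<chi> i j. f $ i * g $ j - f $ j * g $ i)"

definition escale :: "'a::comm_ring_1 \<Rightarrow> ('a, 'v::finite) array \<Rightarrow> ('a, 'v) array" where
  "escale c F = (\<chi> i j. c * F $ i $ j)"

definition edges :: "('v::linorder \<times> 'v) set" where
  "edges = {(i, j). i < j}"

definition einner ::
  "('a::comm_star_ring, 'v::{finite,linorder}) array \<Rightarrow> ('a, 'v) array \<Rightarrow> 'a" where
  "einner F G = (\<Sum>(i, j)\<in>edges. star (F $ i $ j) * G $ i $ j)"

definition delta ::
  "('v::{finite,linorder} \<Rightarrow> 'v \<Rightarrow> 'a::comm_ring_1) \<Rightarrow> ('a, 'v) vec \<Rightarrow> ('a, 'v) array" where
  "delta w f =
     (\<Sum>(i, j)\<in>edges. escale (w i j * (f $ i - f $ j)) (wedge (vbasis i) (vbasis j)))"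

definition boundary ::
  "('a::comm_ring_1, 'v::{finite,linorder}) array \<Rightarrow> ('a, 'v) vec" where
  "boundary F = (\<Sum>(i, j)\<in>edges. F $ i $ j *s (vbasis i - vbasis j))"

text \<open>The adjoint of a map from vertex functions to the exterior square, with respect to the
  two inner products.  Uniqueness of the described vector is \<open>vinner_nondegenerate\<close>; for
  \<open>delta w\<close> existence is \<open>delta_adjoint_exists\<close>, so that \<open>einner_delta\<close> holds.\<close>

definition edge_adjoint ::
  "(('a::comm_star_ring, 'v::{finite,linorder}) vec \<Rightarrow> ('a, 'v) array) \<Rightarrow>
     ('a, 'v) array \<Rightarrow> ('a, 'v) vec" where
  "edge_adjoint T F = (THE g. \<forall>f. vinner g f = einner F (T f))"

section \<open>Basic facts\<close>

lemma star_0 [simp]: "star (0::'a::comm_star_ring) = 0"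
  using star_add[of "0::'a" 0] by simp

lemma star_minus: "star (- a) = - star (a::'a::comm_star_ring)"
  using star_add[of a "- a"] by (simp add: minus_unique)

lemma star_sum: "star (sum f A) = (\<Sum>x\<in>A. star (f x :: 'a::comm_star_ring))"
  by (induction A rule: infinite_finite_induct) (simp_all add: star_add)

lemma star_1 [simp]: "star (1::'a::comm_star_ring) = 1"
  by (metis mult.right_neutral mult.commute star_mult star_star)

lemma vbasis_nth: "vbasis i $ k = (if k = i then 1 else 0)"
  by (simp add: vbasis_def axis_def)

lemma wedge_vbasis_nth:
  "wedge (vbasis i) (vbasis j) $ k $ l =
     (if k = i \<and> l = j then 1 else 0) - (if k = j \<and> l = i then 1 else 0)"
  unfolding wedge_def vec_lambda_beta vbasis_nth
  by (cases "k = i"; cases "l = j"; cases "k = j"; cases "l = i") simp_all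

lemma wedge_in_ext2: "wedge f g \<in> ext2"
  by (simp add: ext2_def wedge_def mult.commute)

lemma sum_edges_nth:
  fixes c :: "'v::{finite,linorder} \<Rightarrow> 'v \<Rightarrow> 'a::comm_ring_1"
  shows "(\<Sum>(i, j)\<in>edges. escale (c i j) (wedge (vbasis i) (vbasis j))) $ k $ l =
    (if k < l then c k l else if l < k then - c l k else 0)"
proof -
  have "(case p of (i, j) \<Rightarrow> escale (c i j) (wedge (vbasis i) (vbasis j))) $ k $ l =
      (if p = (k, l) then c k l else 0) - (if p = (l, k) then c l k else 0)" for p
  proof (cases p)
    case (Pair i j)
    show ?thesis
      unfolding Pair prod.case escale_def vec_lambda_beta wedge_vbasis_nth prod.inject
      by (cases "k = i"; cases "l = j"; cases "k = j"; cases "l = i") simp_all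
  qed
  then have "(\<Sum>(i, j)\<in>edges. escale (c i j) (wedge (vbasis i) (vbasis j))) $ k $ l =
     (\<Sum>p\<in>edges. (if p = (k, l) then c k l else 0) - (if p = (l, k) then c l k else 0))"
    unfolding sum_component by simp
  also have "\<dots> = (if (k, l) \<in> edges then c k l else 0) - (if (l, k) \<in> edges then c l k else 0)"
    unfolding sum_subtractf by simp
  also have "\<dots> = (if k < l then c k l else if l < k then - c l k else 0)"
    by (cases k l rule: linorder_cases) (simp_all add: edges_def)
  finally show ?thesis .
qed

lemma ext2_expansion:
  assumes "F \<in> ext2"
  shows "F = (\<Sum>(i, j)\<in>edges. escale (F $ i $ j) (wedge (vbasis i) (vbasis j)))"
  unfolding vec_eq_iff sum_edges_nth
proof (intro allI)
  fix k l
  have "F $ k $ k = 0" "F $ k $ l = - (F $ l $ k)"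
    using assms unfolding ext2_def by blast+
  then show "F $ k $ l =
      (if k < l then F $ k $ l else if l < k then - (F $ l $ k) else 0)"
    by (metis linorder_less_linear)
qed

lemma delta_nth:
  assumes "admissible_weights w"
  shows "delta w f $ k $ l = w k l * (f $ k - f $ l)"
proof -
  have sym: "w l k = w k l"
    using assms unfolding admissible_weights_def by blast
  show ?thesis
  proof (rule linorder_cases[of k l])
    assume "l < k"
    then have "delta w f $ k $ l = - (w l k * (f $ l - f $ k))"
      unfolding delta_def sum_edges_nth by auto
    also have "\<dots> = w k l * (f $ k - f $ l)"
      unfolding sym by (simp add: right_diff_distrib)
    finally show ?thesis .
  qed (auto simp only: delta_def sum_edges_nth if_True if_False less_irrefl diff_self mult_zero_right)
qed

lemma delta_in_ext2:
  assumes "admissible_weights w"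
  shows "delta w f \<in> ext2"
proof -
  have "w k l * (f $ k - f $ l) = - (w l k * (f $ l - f $ k))" for k l
  proof -
    have "w k l = w l k"
      using assms unfolding admissible_weights_def by blast
    then have "w k l * (f $ k - f $ l) = w l k * (f $ k - f $ l)" by (simp only:)
    also have "\<dots> = - (w l k * (f $ l - f $ k))" by (simp add: right_diff_distrib)
    finally show ?thesis .
  qed
  moreover have "w k k * (f $ k - f $ k) = 0" for k
    by simp
  ultimately show ?thesis
    unfolding ext2_def mem_Collect_eq delta_nth[OF assms] by blast
qed

lemma delta_vbasis:
  assumes "admissible_weights w"
  shows "delta w (vbasis i) = (\<Sum>j\<in>UNIV. escale (w i j) (wedge (vbasis i) (vbasis j)))"
proof -
  have "(\<Sum>j\<in>UNIV. escale (w i j) (wedge (vbasis i) (vbasis j))) $ k $ l =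
      w k l * (vbasis i $ k - vbasis i $ l)" for k l
  proof -
    have "(\<Sum>j\<in>UNIV. escale (w i j) (wedge (vbasis i) (vbasis j))) $ k $ l =
      (\<Sum>j\<in>UNIV. (if j = l then (if k = i then w i l else 0) else 0)
         - (if j = k then (if l = i then w i k else 0) else 0))"
      unfolding sum_component escale_def vec_lambda_beta wedge_vbasis_nth
    proof (intro sum.cong refl)
      fix j
      show "w i j * ((if k = i \<and> l = j then 1 else 0) - (if k = j \<and> l = i then 1 else 0)) =
        (if j = l then (if k = i then w i l else 0) else 0)
         - (if j = k then (if l = i then w i k else 0) else 0)"
        by (cases "k = i"; cases "j = l"; cases "j = k"; cases "l = i") simp_all
    qed
    also have "\<dots> = (if k = i then w i l else 0) - (if l = i then w i k else 0)"
      unfolding sum_subtractf by simp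
    also have "\<dots> = w k l * (vbasis i $ k - vbasis i $ l)"
    proof -
      have "w k i = w i k" "w i i = 0"
        using assms unfolding admissible_weights_def by blast+
      then show ?thesis by (cases "k = i"; cases "l = i") (simp_all add: vbasis_nth)
    qed
    finally show ?thesis .
  qed
  then show ?thesis
    by (simp add: vec_eq_iff delta_nth[OF assms])
qed

lemma boundary_add: "boundary (F + G) = boundary F + boundary G"
  unfolding boundary_def sum.distrib[symmetric] split_def
  by (intro sum.cong refl) (simp add: vec_eq_iff distrib_right)

lemma boundary_escale: "boundary (escale c F) = c *s boundary F"
proof -
  have "boundary (escale c F) $ i = (c *s boundary F) $ i" for i
    unfolding boundary_def escale_def vec_lambda_beta split_def sum_component
      vector_smult_component sum_distrib_left mult.assoc ..
  then show ?thesis by (simp add: vec_eq_iff)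
qed

lemma boundary_wedge:
  assumes "i < j"
  shows "boundary (wedge (vbasis i) (vbasis j)) = vbasis i - vbasis j"
proof -
  have "boundary (wedge (vbasis i) (vbasis j)) =
     (\<Sum>p\<in>edges. if p = (i, j) then vbasis i - vbasis j else 0)"
    unfolding boundary_def
  proof (intro sum.cong refl)
    fix p :: "'a \<times> 'a" assume "p \<in> edges"
    then obtain k l where p: "p = (k, l)" "k < l"
      by (auto simp: edges_def)
    then have "\<not> (k = j \<and> l = i)"
      using assms by (metis order.asym)
    then show "(case p of (k, l) \<Rightarrow>
        wedge (vbasis i) (vbasis j) $ k $ l *s (vbasis k - vbasis l)) =
        (if p = (i, j) then vbasis i - vbasis j else 0)"
      unfolding p(1) prod.case wedge_vbasis_nth prod.inject
      by (cases "k = i \<and> l = j") (simp_all only: if_True if_False simp_thms diff_zero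
          vector_smult_lid vector_smult_lzero)
  qed
  then show ?thesis using assms by (simp add: edges_def)
qed

lemma einner_orthonormal:
  assumes "i < j" "k < l"
  shows "einner (wedge (vbasis i) (vbasis j)) (wedge (vbasis k) (vbasis l)) =
    (if (i, j) = (k, l) then 1 else 0)"
proof -
  have coord: "wedge (vbasis i) (vbasis j) $ a $ b = (if (a, b) = (i, j) then 1 else 0)"
    if "i < j" "a < b" for i j a b :: 'a
  proof -
    have "\<not> (a = j \<and> b = i)"
      using that by (metis order.asym)
    then show ?thesis
      unfolding wedge_vbasis_nth prod.inject by (simp only: if_False diff_zero)
  qed
  have "einner (wedge (vbasis i) (vbasis j)) (wedge (vbasis k) (vbasis l)) =
     (\<Sum>p\<in>edges. if p = (i, j) then (if (i, j) = (k, l) then 1 else 0) else 0)"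
    unfolding einner_def
  proof (intro sum.cong refl)
    fix p :: "'a \<times> 'a" assume "p \<in> edges"
    then obtain a b where p: "p = (a, b)" "a < b"
      by (auto simp: edges_def)
    show "(case p of (a, b) \<Rightarrow> star (wedge (vbasis i) (vbasis j) $ a $ b) *
          wedge (vbasis k) (vbasis l) $ a $ b) =
        (if p = (i, j) then (if (i, j) = (k, l) then 1 else 0) else 0)"
      unfolding p(1) prod.case coord[OF assms(1) p(2)] coord[OF assms(2) p(2)]
      by (cases "(a, b) = (i, j)") (simp_all del: prod.inject)
  qed
  then show ?thesis using assms by (simp add: edges_def)
qed

lemma vinner_vbasis: "vinner g (vbasis k) = star (g $ k)"
proof -
  have "vinner g (vbasis k) = (\<Sum>i\<in>UNIV. if i = k then star (g $ k) else 0)"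
    unfolding vinner_def by (intro sum.cong) (auto simp: vbasis_nth)
  then show ?thesis by simp
qed

lemma vinner_nondegenerate:
  assumes "\<And>f. vinner g f = vinner h f"
  shows "g = h"
  by (metis assms vinner_vbasis star_star vec_eq_iff)

lemma delta_adjoint_exists: "\<exists>g. \<forall>f. vinner g f = einner F (delta w f)"
proof -
  define c where "c i j = star (F $ i $ j) * w i j" for i j
  define g where "g = (\<chi> k. star (\<Sum>(i, j)\<in>edges.
     c i j * ((if k = i then 1 else 0) - (if k = j then 1 else 0))))"
  have "vinner g f = einner F (delta w f)" for f
  proof -
    have "vinner g f = (\<Sum>k\<in>UNIV. \<Sum>p\<in>edges. c (fst p) (snd p) *
       ((if k = fst p then f $ k else 0) - (if k = snd p then f $ k else 0)))"
      by (simp add: vinner_def g_def sum_distrib_right split_def)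
         (auto intro!: sum.cong)
    also have "\<dots> = (\<Sum>p\<in>edges. c (fst p) (snd p) * (f $ fst p - f $ snd p))"
      by (subst sum.swap) (simp add: sum_distrib_left[symmetric] sum_subtractf)
    also have "\<dots> = einner F (delta w f)"
      unfolding einner_def delta_def sum_edges_nth
      by (intro sum.cong) (auto simp: edges_def c_def algebra_simps)
    finally show ?thesis .
  qed
  then show ?thesis by blast
qed

lemma einner_delta: "vinner (edge_adjoint (delta w) F) f = einner F (delta w f)"
proof -
  have "\<exists>!g. \<forall>f. vinner g f = einner F (delta w f)"
    using delta_adjoint_exists vinner_nondegenerate by metis
  from theI'[OF this] show ?thesis
    unfolding edge_adjoint_def by blast
qed

end

theory Submission
  imports Defs
begin

text \<open>Each of \<open>\<partial>\<close> and \<open>\<delta>\<^sup>\<dagger>\<close> is evaluated at a vertex \<open>k\<close>.  The edges starting at \<open>k\<close> and those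
  ending at \<open>k\<close> enter with opposite signs, and alternation merges them into one sum over all
  vertices: \<open>(\<partial>F)\<^sub>k = (\<Sum>j. F\<^sub>k\<^sub>j)\<close> and \<open>(\<delta>\<^sup>\<dagger>F)\<^sub>k = (\<Sum>j. w\<^sub>k\<^sub>j F\<^sub>k\<^sub>j)\<close>.  For the square, the
  orthogonality of the weights reduces \<open>w\<^sub>i\<^sub>j (\<Delta> f)\<^sub>i\<close> to \<open>w\<^sub>i\<^sub>j\<^sup>2 (f\<^sub>i - f\<^sub>j)\<close>, and \<open>w\<^sub>i\<^sub>j (\<Delta> f)\<^sub>j\<close>
  to its negative.\<close>

text \<open>Shared core of both evaluations: \<open>boundary\<close> uses it for \<open>F\<close>
  itself, the adjoint of \<open>delta w\<close> for a reweighted array.\<close>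

lemma sum_edges_incidence:
  fixes F :: "('a::comm_ring_1, 'v::{finite,linorder}) array"
  assumes "F \<in> ext2"
  shows "(\<Sum>(i, j)\<in>edges. F $ i $ j * (vbasis i $ k - vbasis j $ k)) = (\<Sum>j\<in>UNIV. F $ k $ j)"
proof -
  have alt: "F $ i $ i = 0" "F $ j $ i = - (F $ i $ j)" for i j
    using assms unfolding ext2_def by blast+
  \<comment> \<open>Padding with zeros off the edges turns the edge sum into a double sum over all
    vertices, whose two indices can then be collapsed independently.\<close>
  have "(\<Sum>(i, j)\<in>edges. F $ i $ j * (vbasis i $ k - vbasis j $ k)) =
      (\<Sum>(i, j)\<in>UNIV. if i < j then F $ i $ j * (vbasis i $ k - vbasis j $ k) else 0)"
    by (intro sum.mono_neutral_cong_left) (auto simp: edges_def split: if_splits)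
  also have "\<dots> = (\<Sum>i\<in>UNIV. \<Sum>j\<in>UNIV.
      (if i = k then if i < j then F $ i $ j else 0 else 0)
      - (if j = k then if i < j then F $ i $ j else 0 else 0))"
    unfolding UNIV_Times_UNIV[symmetric] sum.cartesian_product[symmetric]
    by (intro sum.cong refl) (auto simp: vbasis_nth)
  also have "\<dots> = (\<Sum>j\<in>UNIV. if k < j then F $ k $ j else 0)
      - (\<Sum>i\<in>UNIV. if i < k then F $ i $ k else 0)"
  proof -
    \<comment> \<open>Here the outer index is the one pinned to \<open>k\<close>; exchanging the
      sums makes it the inner one, where the indicator collapses.\<close>
    have "(\<Sum>i\<in>UNIV. \<Sum>j\<in>UNIV. if i = k then if i < j then F $ i $ j else 0 else 0) =
        (\<Sum>j\<in>UNIV. if k < j then F $ k $ j else 0)"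
      by (subst sum.swap) simp
    then show ?thesis by (simp add: sum_subtractf)
  qed
  also have "\<dots> = (\<Sum>j\<in>UNIV. F $ k $ j)"
    unfolding sum_subtractf[symmetric]
  proof (intro sum.cong refl)
    \<comment> \<open>For \<open>j < k\<close> alternation turns \<open>- F $ j $ k\<close> into
      \<open>F $ k $ j\<close>; at \<open>j = k\<close> both sides vanish.\<close>
    fix j
    show "(if k < j then F $ k $ j else 0) - (if j < k then F $ j $ k else 0) = F $ k $ j"
      using alt(1)[of k] alt(2)[of j k]
      by (cases k j rule: linorder_cases) auto
  qed
  finally show ?thesis .
qed

lemma boundary_nth:
  assumes "F \<in> ext2"
  shows "boundary F $ k = (\<Sum>j\<in>UNIV. F $ k $ j)"
  unfolding sum_edges_incidence[OF assms, symmetric] boundary_def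
  by (simp only: sum_component split_def vector_smult_component vector_minus_component)

lemma edge_adjoint_delta_nth:
  assumes w: "admissible_weights w" and F: "F \<in> ext2"
  shows "edge_adjoint (delta w) F $ k = (\<Sum>j\<in>UNIV. w k j * F $ k $ j)"
proof -
  have sym: "w j i = w i j" and self: "star (w i j) = w i j" for i j
    using w unfolding admissible_weights_def by blast+
  have alt: "F $ i $ i = 0" "F $ j $ i = - (F $ i $ j)" for i j
    using F unfolding ext2_def by blast+
  \<comment> \<open>\<open>G\<close> collects the factors that multiply the difference of the values
    of \<open>f\<close> in \<open>einner F (delta w f)\<close>. Symmetry of \<open>w\<close> keeps
    it alternating.\<close>
  define G where "G = (\<chi> i j. w i j * star (F $ i $ j))"
  have "G \<in> ext2"
    unfolding ext2_def mem_Collect_eq G_def vec_lambda_beta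
  proof (intro conjI allI)
    fix i j
    show "w i i * star (F $ i $ i) = 0"
      unfolding alt(1) by simp
    show "w j i * star (F $ j $ i) = - (w i j * star (F $ i $ j))"
      unfolding sym[of i j] alt(2)[of i j] by (simp add: star_minus)
  qed
  \<comment> \<open>Pairing with the basis vector at \<open>k\<close> reads off the starred
    coordinate at \<open>k\<close>.\<close>
  have "star (edge_adjoint (delta w) F $ k) = einner F (delta w (vbasis k))"
    unfolding vinner_vbasis[symmetric] einner_delta ..
  also have "\<dots> = (\<Sum>(i, j)\<in>edges. G $ i $ j * (vbasis i $ k - vbasis j $ k))"
    unfolding einner_def delta_nth[OF w] G_def vec_lambda_beta
    by (intro sum.cong refl) (auto simp: vbasis_nth)
  also have "\<dots> = (\<Sum>j\<in>UNIV. G $ k $ j)"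
    by (rule sum_edges_incidence[OF \<open>G \<in> ext2\<close>])
  \<comment> \<open>The weights are self-adjoint, so the star can be pulled out of the sum; the
    involution then cancels it on both sides.\<close>
  also have "\<dots> = star (\<Sum>j\<in>UNIV. w k j * F $ k $ j)"
    unfolding G_def vec_lambda_beta star_sum star_mult self ..
  finally show ?thesis
    by (metis star_star)
qed

lemma laplacian_nth: "laplacian w f $ i = (\<Sum>j\<in>UNIV. w i j * (f $ i - f $ j))"
  by (simp add: laplacian_def)

lemma laplacian_eq_boundary_delta:
  assumes "admissible_weights w"
  shows "laplacian w f = boundary (delta w f)"
  unfolding vec_eq_iff laplacian_nth boundary_nth[OF delta_in_ext2[OF assms]] delta_nth[OF assms]
  by simp

text \<open>With the constant 1 in the first slot, the difference in the bracket becomes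
  \<open>f $ j - f $ i\<close>, the opposite of the one in the Laplacian.\<close>

lemma laplacian_eq_bracket: "laplacian w f = - bracket w (vec 1) f"
  by (simp add: vec_eq_iff laplacian_nth bracket_def sum_negf[symmetric] algebra_simps)

text \<open>\<open>delta w\<close> supplies one factor of the weight and its adjoint a second
  one.\<close>

lemma edge_adjoint_delta_delta:
  assumes "admissible_weights w"
  shows "edge_adjoint (delta w) (delta w f) = laplacian (\<lambda>i k. (w i k)\<^sup>2) f"
  unfolding vec_eq_iff laplacian_nth
    edge_adjoint_delta_nth[OF assms delta_in_ext2[OF assms]] delta_nth[OF assms]
  by (simp only: power2_eq_square mult.assoc simp_thms)

lemma laplacian_laplacian:
  fixes w :: "'v::finite \<Rightarrow> 'v \<Rightarrow> 'a::comm_ring_1"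
  assumes sym: "\<And>i j. w i j = w j i"
    and orth: "\<And>i j k. j \<noteq> k \<Longrightarrow> w i j * w i k = 0"
  shows "laplacian w (laplacian w f) = 2 *s laplacian (\<lambda>i k. (w i k)\<^sup>2) f"
proof -
  have collapse: "w i j * laplacian w f $ i = (w i j)\<^sup>2 * (f $ i - f $ j)" for i j
  proof -
    have "w i j * laplacian w f $ i = (\<Sum>k\<in>UNIV. w i j * w i k * (f $ i - f $ k))"
      by (simp add: laplacian_nth sum_distrib_left mult.assoc)
    \<comment> \<open>Orthogonality at the vertex \<open>i\<close> kills every term with
      \<open>k\<close> different from \<open>j\<close>.\<close>
    also have "\<dots> = (\<Sum>k\<in>UNIV. if k = j then (w i j)\<^sup>2 * (f $ i - f $ j) else 0)"
      by (intro sum.cong refl) (auto simp: orth power2_eq_square)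
    finally show ?thesis by simp
  qed
  have "w i j * (laplacian w f $ i - laplacian w f $ j) = 2 * ((w i j)\<^sup>2 * (f $ i - f $ j))"
    for i j
  proof -
    \<comment> \<open>The same collapse seen from the other endpoint of the edge; the reversed sign
      makes the two contributions add up, whence the factor 2.\<close>
    have "w i j * laplacian w f $ j = (w i j)\<^sup>2 * (f $ j - f $ i)"
      using collapse[of j i] unfolding sym[of j i] .
    then show ?thesis
      unfolding right_diff_distrib[of "w i j"] collapse[of i j] by (simp add: algebra_simps)
  qed
  then show ?thesis
    by (simp add: vec_eq_iff laplacian_nth[of w "laplacian w f"] laplacian_nth[of _ f]
        sum_distrib_left)
qed

text \<open>Stated over any commutative ring with involution, so that \<open>complex ^ 'q\<close>
  and \<open>real ^ 'q\<close> are both instances.\<close>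

lemma laplacian_identities:
  fixes w :: "'v::{finite,linorder} \<Rightarrow> 'v \<Rightarrow> 'a::comm_star_ring"
  assumes w: "admissible_weights w"
  shows
    "(\<forall>f. laplacian w f = boundary (delta w f) \<and>
          boundary (delta w f) = - bracket w (vec 1) f) \<and>
     (\<forall>f j. edge_adjoint (delta w) (delta w f) $ j = laplacian (\<lambda>i k. (w i k)\<^sup>2) f $ j \<and>
            laplacian (\<lambda>i k. (w i k)\<^sup>2) f $ j = (\<Sum>k\<in>UNIV. (w j k)\<^sup>2 * (f $ j - f $ k))) \<and>
     ((\<forall>i j k. j \<noteq> k \<longrightarrow> w i j * w i k = 0) \<longrightarrow>
        laplacian w ^^ 2 = (\<lambda>f. 2 *s laplacian (\<lambda>i k. (w i k)\<^sup>2) f) \<and>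
        (\<lambda>f. 2 *s laplacian (\<lambda>i k. (w i k)\<^sup>2) f) =
          (\<lambda>f. 2 *s edge_adjoint (delta w) (delta w f)))"
proof (intro conjI allI impI)
  have sym: "w i j = w j i" for i j
    using w unfolding admissible_weights_def by blast
  assume orth: "\<forall>i j k. j \<noteq> k \<longrightarrow> w i j * w i k = 0"
  show "laplacian w ^^ 2 = (\<lambda>f. 2 *s laplacian (\<lambda>i k. (w i k)\<^sup>2) f)"
  proof
    fix f
    have "(laplacian w ^^ 2) f = laplacian w (laplacian w f)"
      by (simp add: numeral_2_eq_2)
    also have "\<dots> = 2 *s laplacian (\<lambda>i k. (w i k)\<^sup>2) f"
      using sym orth by (intro laplacian_laplacian) blast+
    finally show "(laplacian w ^^ 2) f = 2 *s laplacian (\<lambda>i k. (w i k)\<^sup>2) f" .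
  qed
\<comment> \<open>Fixing \<open>w\<close> in \<open>laplacian_eq_bracket\<close> leaves the
  Laplacian with squared weights untouched by that rewriting.\<close>
qed (simp_all only: edge_adjoint_delta_delta[OF w] laplacian_nth
    laplacian_eq_boundary_delta[OF w, symmetric] laplacian_eq_bracket[of w])

theorem theorem3p8:
  fixes w :: "'v::{finite,linorder} \<Rightarrow> 'v \<Rightarrow> complex ^ 'q"
    and u :: "'v \<Rightarrow> 'v \<Rightarrow> real ^ 'q"
  shows
    "(admissible_weights w \<longrightarrow>
        (\<forall>f. laplacian w f = boundary (delta w f) \<and>
             boundary (delta w f) = - bracket w (vec 1) f) \<and>
        (\<forall>f j. edge_adjoint (delta w) (delta w f) $ j = laplacian (\<lambda>i k. (w i k)\<^sup>2) f $ j \<and>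
               laplacian (\<lambda>i k. (w i k)\<^sup>2) f $ j = (\<Sum>k\<in>UNIV. (w j k)\<^sup>2 * (f $ j - f $ k))) \<and>
        ((\<forall>i j k. j \<noteq> k \<longrightarrow> w i j * w i k = 0) \<longrightarrow>
           laplacian w ^^ 2 = (\<lambda>f. 2 *s laplacian (\<lambda>i k. (w i k)\<^sup>2) f) \<and>
           (\<lambda>f. 2 *s laplacian (\<lambda>i k. (w i k)\<^sup>2) f) =
             (\<lambda>f. 2 *s edge_adjoint (delta w) (delta w f))))
     \<and>
     (admissible_weights u \<longrightarrow>
        (\<forall>f. laplacian u f = boundary (delta u f) \<and>
             boundary (delta u f) = - bracket u (vec 1) f) \<and>
        (\<forall>f j. edge_adjoint (delta u) (delta u f) $ j = laplacian (\<lambda>i k. (u i k)\<^sup>2) f $ j \<and>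
               laplacian (\<lambda>i k. (u i k)\<^sup>2) f $ j = (\<Sum>k\<in>UNIV. (u j k)\<^sup>2 * (f $ j - f $ k))) \<and>
        ((\<forall>i j k. j \<noteq> k \<longrightarrow> u i j * u i k = 0) \<longrightarrow>
           laplacian u ^^ 2 = (\<lambda>f. 2 *s laplacian (\<lambda>i k. (u i k)\<^sup>2) f) \<and>
           (\<lambda>f. 2 *s laplacian (\<lambda>i k. (u i k)\<^sup>2) f) =
             (\<lambda>f. 2 *s edge_adjoint (delta u) (delta u f))))"
  by (intro conjI impI laplacian_identities)

end
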